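(* Let $d\ge 1$, let $\Sigma_1,\Sigma_2\in\mathbb{R}^{d\times d}$ be symmetric positive definite matrices, let $m\in\mathbb{R}^d$, and set $$\mathsf{k}(x,y) := \exp\left(-\tfrac12 (x-y)^T\Sigma_1^{-1}(x-y)\right),\qquad V(x) := \tfrac12 (x-m)^T\Sigma_2^{-1}(x-m),\qquad x,y\in\mathbb{R}^d.$$ Then for every $\beta>0$ and for $\lambda=(1+\beta)^{-1}$, the function $\rho^\star(x):=\exp(-V(x))$ is a stationary solution of the polarized consensus-based sampling Fokker--Planck equation $$\partial_t\rho_t(x) = \operatorname{div}\big(\rho_t(x)\,(x-\mathsf{m}_{\beta,\mathsf{k}}[\rho_t](x))\big)+\lambda^{-1}\operatorname{div}\big(\mathsf{C}_{\beta,\mathsf{k}}[\rho_t](x)\,\nabla\rho_t(x)\big),$$ where $\mathsf{m}_{\beta,\mathsf{k}}$ and $\mathsf{C}_{\beta,\mathsf{k}}$ are the weighted mean and the weighted covariance associated with $\mathsf{k}$, $V$ and $\beta$.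
   Context: All integrals are over $\mathbb{R}^d$. For a (finite, not necessarily normalized) measure $\rho$ on $\mathbb{R}^d$, a kernel $\mathsf{k}:\mathbb{R}^d\times\mathbb{R}^d\to[0,\infty)$, an objective $V:\mathbb{R}^d\to[0,\infty)$ and $\beta>0$, the weighted mean and weighted covariance at $x\in\mathbb{R}^d$ are $$\mathsf{m}_{\beta,\mathsf{k}}[\rho](x) := \frac{\int \mathsf{k}(x,y)\,y\,\exp(-\beta V(y))\,d\rho(y)}{\int \mathsf{k}(x,y)\exp(-\beta V(y))\,d\rho(y)},$$ $$\mathsf{C}_{\beta,\mathsf{k}}[\rho](x) := \frac{\int \mathsf{k}(x,y)\,(y-\mathsf{m}_{\beta,\mathsf{k}}[\rho](x))\otimes(y-\mathsf{m}_{\beta,\mathsf{k}}[\rho](x))\,\exp(-\beta V(y))\,d\rho(y)}{\int \mathsf{k}(x,y)\exp(-\beta V(y))\,d\rho(y)}.$$ A measure is identified with its Lebesgue density, i.e. $d\rho^\star(y)=\rho^\star(y)\,dy$. A density $\rho^\star$ is a stationary solution if the time-constant curve $\rho_t=\rho^\star$ solves the equation, i.e. if the right-hand side of the equation vanishes for $\rho_t=\rho^\star$. *)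

theory Defs
  imports "HOL-Analysis.Analysis"
begin

definition sym_pos_def :: "real^'n^'n \<Rightarrow> bool" where
  "sym_pos_def A \<longleftrightarrow> transpose A = A \<and> (\<forall>x. x \<noteq> 0 \<longrightarrow> 0 < x \<bullet> (A *v x))"

definition outer_product :: "real^'n \<Rightarrow> real^'n \<Rightarrow> real^'n^'n" where
  "outer_product u v = (\<chi> i j. u $ i * v $ j)"

text \<open>The gradient and the divergence are meaningful only at points of differentiability;
  differentiability is demanded separately wherever they are used.\<close>

definition gradient :: "(real^'n \<Rightarrow> real) \<Rightarrow> real^'n \<Rightarrow> real^'n" where
  "gradient f x = (THE D. GDERIV f x :> D)"

definition divergence :: "(real^'n \<Rightarrow> real^'n) \<Rightarrow> real^'n \<Rightarrow> real" where
  "divergence F x = trace (jacobian F (at x))"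

definition weight ::
  "(real^'n \<Rightarrow> real^'n \<Rightarrow> real) \<Rightarrow> (real^'n \<Rightarrow> real) \<Rightarrow> real \<Rightarrow> real^'n \<Rightarrow> real^'n \<Rightarrow> real" where
  "weight k V \<beta> x y = k x y * exp (- \<beta> * V y)"

definition weighted_mean ::
  "(real^'n \<Rightarrow> real^'n \<Rightarrow> real) \<Rightarrow> (real^'n \<Rightarrow> real) \<Rightarrow> real \<Rightarrow> (real^'n) measure \<Rightarrow>
    real^'n \<Rightarrow> real^'n" where
  "weighted_mean k V \<beta> \<rho> x =
    (LINT y|\<rho>. weight k V \<beta> x y *\<^sub>R y) /\<^sub>R (LINT y|\<rho>. weight k V \<beta> x y)"

definition weighted_cov ::
  "(real^'n \<Rightarrow> real^'n \<Rightarrow> real) \<Rightarrow> (real^'n \<Rightarrow> real) \<Rightarrow> real \<Rightarrow> (real^'n) measure \<Rightarrow>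
    real^'n \<Rightarrow> real^'n^'n" where
  "weighted_cov k V \<beta> \<rho> x =
    (LINT y|\<rho>. weight k V \<beta> x y *\<^sub>R
        outer_product (y - weighted_mean k V \<beta> \<rho> x) (y - weighted_mean k V \<beta> \<rho> x))
      /\<^sub>R (LINT y|\<rho>. weight k V \<beta> x y)"

text \<open>Divergent integrals and division by zero have the junk value zero; this predicate
  says that the two quotients above exist in the ordinary sense.\<close>

definition weighted_moments_exist ::
  "(real^'n \<Rightarrow> real^'n \<Rightarrow> real) \<Rightarrow> (real^'n \<Rightarrow> real) \<Rightarrow> real \<Rightarrow> (real^'n) measure \<Rightarrow>
    real^'n \<Rightarrow> bool" where
  "weighted_moments_exist k V \<beta> \<rho> x \<longleftrightarrow>
    integrable \<rho> (\<lambda>y. weight k V \<beta> x y) \<and>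
    (LINT y|\<rho>. weight k V \<beta> x y) \<noteq> 0 \<and>
    integrable \<rho> (\<lambda>y. weight k V \<beta> x y *\<^sub>R y) \<and>
    integrable \<rho> (\<lambda>y. weight k V \<beta> x y *\<^sub>R
      outer_product (y - weighted_mean k V \<beta> \<rho> x) (y - weighted_mean k V \<beta> \<rho> x))"

text \<open>Densities need not be normalized. Below, \<open>l\<close> stands for the parameter \<open>\<lambda>\<close>, which cannot be used as a
  variable name.\<close>

definition is_density :: "(real^'n \<Rightarrow> real) \<Rightarrow> bool" where
  "is_density \<rho> \<longleftrightarrow> (\<forall>x. 0 \<le> \<rho> x) \<and> integrable lborel \<rho>"

definition measure_of_density :: "(real^'n \<Rightarrow> real) \<Rightarrow> (real^'n) measure" where
  "measure_of_density \<rho> = density lborel (\<lambda>x. ennreal (\<rho> x))"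

definition drift_flux ::
  "(real^'n \<Rightarrow> real^'n \<Rightarrow> real) \<Rightarrow> (real^'n \<Rightarrow> real) \<Rightarrow> real \<Rightarrow> (real^'n \<Rightarrow> real) \<Rightarrow>
    real^'n \<Rightarrow> real^'n" where
  "drift_flux k V \<beta> \<rho> x =
    \<rho> x *\<^sub>R (x - weighted_mean k V \<beta> (measure_of_density \<rho>) x)"

definition diffusion_flux ::
  "(real^'n \<Rightarrow> real^'n \<Rightarrow> real) \<Rightarrow> (real^'n \<Rightarrow> real) \<Rightarrow> real \<Rightarrow> (real^'n \<Rightarrow> real) \<Rightarrow>
    real^'n \<Rightarrow> real^'n" where
  "diffusion_flux k V \<beta> \<rho> x =
    weighted_cov k V \<beta> (measure_of_density \<rho>) x *v gradient \<rho> x"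

definition fokker_planck_rhs ::
  "(real^'n \<Rightarrow> real^'n \<Rightarrow> real) \<Rightarrow> (real^'n \<Rightarrow> real) \<Rightarrow> real \<Rightarrow> real \<Rightarrow> (real^'n \<Rightarrow> real) \<Rightarrow>
    real^'n \<Rightarrow> real" where
  "fokker_planck_rhs k V \<beta> l \<rho> x =
    divergence (drift_flux k V \<beta> \<rho>) x + inverse l * divergence (diffusion_flux k V \<beta> \<rho>) x"

definition fokker_planck_rhs_exists ::
  "(real^'n \<Rightarrow> real^'n \<Rightarrow> real) \<Rightarrow> (real^'n \<Rightarrow> real) \<Rightarrow> real \<Rightarrow> (real^'n \<Rightarrow> real) \<Rightarrow> bool" where
  "fokker_planck_rhs_exists k V \<beta> \<rho> \<longleftrightarrow>
    is_density \<rho> \<and>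
    (\<forall>x. weighted_moments_exist k V \<beta> (measure_of_density \<rho>) x \<and>
         \<rho> differentiable (at x) \<and>
         drift_flux k V \<beta> \<rho> differentiable (at x) \<and>
         diffusion_flux k V \<beta> \<rho> differentiable (at x))"

text \<open>Classical (pointwise) solutions on the time interval from \<open>0\<close> to infinity.\<close>

definition fokker_planck_solution ::
  "(real^'n \<Rightarrow> real^'n \<Rightarrow> real) \<Rightarrow> (real^'n \<Rightarrow> real) \<Rightarrow> real \<Rightarrow> real \<Rightarrow>
    (real \<Rightarrow> real^'n \<Rightarrow> real) \<Rightarrow> bool" where
  "fokker_planck_solution k V \<beta> l \<rho> \<longleftrightarrow>
    (\<forall>t\<ge>0. fokker_planck_rhs_exists k V \<beta> (\<rho> t) \<and>
      (\<forall>x. ((\<lambda>s. \<rho> s x) has_real_derivative fokker_planck_rhs k V \<beta> l (\<rho> t) x)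
            (at t within {0..})))"

definition stationary_solution ::
  "(real^'n \<Rightarrow> real^'n \<Rightarrow> real) \<Rightarrow> (real^'n \<Rightarrow> real) \<Rightarrow> real \<Rightarrow> real \<Rightarrow> (real^'n \<Rightarrow> real) \<Rightarrow> bool" where
  "stationary_solution k V \<beta> l \<rho> \<longleftrightarrow> fokker_planck_solution k V \<beta> l (\<lambda>t. \<rho>)"

lemma stationary_solution_iff:
  "stationary_solution k V \<beta> l \<rho> \<longleftrightarrow>
    fokker_planck_rhs_exists k V \<beta> \<rho> \<and> (\<forall>x. fokker_planck_rhs k V \<beta> l \<rho> x = 0)"
proof
  assume *: "stationary_solution k V \<beta> l \<rho>"
  have "fokker_planck_rhs k V \<beta> l \<rho> x = 0" for x
  proof -
    have "((\<lambda>s. \<rho> x) has_real_derivative fokker_planck_rhs k V \<beta> l \<rho> x) (at 1 within {0..})"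
      using * by (auto simp: stationary_solution_def fokker_planck_solution_def)
    moreover have "(at (1::real) within {0..}) = at 1"
      by (rule at_within_interior) simp
    ultimately show ?thesis
      using DERIV_unique[OF _ DERIV_const] by fastforce
  qed
  then show "fokker_planck_rhs_exists k V \<beta> \<rho> \<and> (\<forall>x. fokker_planck_rhs k V \<beta> l \<rho> x = 0)"
    using * by (auto simp: stationary_solution_def fokker_planck_solution_def)
qed (simp add: stationary_solution_def fokker_planck_solution_def)

definition gaussian_kernel :: "real^'n^'n \<Rightarrow> real^'n \<Rightarrow> real^'n \<Rightarrow> real" where
  "gaussian_kernel S x y = exp (- (1/2) * ((x - y) \<bullet> (matrix_inv S *v (x - y))))"

definition quadratic_objective :: "real^'n^'n \<Rightarrow> real^'n \<Rightarrow> real^'n \<Rightarrow> real" where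
  "quadratic_objective S m x = 1/2 * ((x - m) \<bullet> (matrix_inv S *v (x - m)))"

end

theory Submission
  imports Defs "HOL-Probability.Distributions"
begin

text \<open>
  Write \<open>A\<close> and \<open>B\<close> for the inverses of \<open>S1\<close> and \<open>S2\<close>, and \<open>\<rho> = exp (- V)\<close>. For fixed \<open>x\<close> the measure
  against which the weighted moments are taken has the density
  \<open>k x y * exp (- \<beta> * V y) * \<rho> y\<close> in \<open>y\<close>. This is the exponential of a quadratic polynomial, so
  completing the square turns it into a constant multiple of the Gaussian with precision matrix
  \<open>P = A + (1 + \<beta>) B\<close> and centre \<open>\<mu> x = m + P\<^sup>-\<^sup>1 A (x - m)\<close>. Hence the weighted mean at \<open>x\<close> is \<open>\<mu> x\<close> and
  the weighted covariance is \<open>P\<^sup>-\<^sup>1\<close>, independently of \<open>x\<close>.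

  From \<open>P (\<mu> x - m) = A (x - m)\<close> one gets \<open>P (x - \<mu> x) = (1 + \<beta>) B (x - m)\<close>, while the gradient of \<open>\<rho>\<close>
  is \<open>- \<rho> x B (x - m)\<close>. The diffusion flux is therefore
  \<open>- \<rho> x P\<^sup>-\<^sup>1 B (x - m) = - (1 + \<beta>)\<^sup>-\<^sup>1 \<rho> x (x - \<mu> x)\<close>, which is \<open>- l\<close> times the drift flux, already
  before taking divergences. Dividing by \<open>l\<close> makes the two terms of the equation cancel.

  The analytic content is the computation of the Gaussian moments (\<open>centred_gaussian_first_moment\<close>,
  \<open>centred_gaussian_second_moment\<close>) and their transfer to the weighted moments
  (\<open>gaussian_weighted_moments\<close>). The first moment vanishes by symmetry, and differentiating this
  along translations yields the second. The covariance \<open>C\<close> is characterized through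
  \<open>C (P u) = u\<close> for all \<open>u\<close>, which is exactly how it acts in the diffusion flux.
\<close>

section \<open>Symmetric positive definite matrices\<close>

text \<open>The quadratic form attains a minimum on the compact unit sphere; that minimum is positive and serves
  as the constant by homogeneity.\<close>
lemma sym_pos_def_coercive:
  fixes P :: "real^'n^'n"
  assumes "sym_pos_def P"
  obtains c where "c > 0" "\<And>z. c * (norm z)\<^sup>2 \<le> z \<bullet> (P *v z)"
proof -
  have "continuous_on (sphere 0 1) (\<lambda>z::real^'n. z \<bullet> (P *v z))"
    by (intro continuous_intros)
  moreover have "sphere (0::real^'n) 1 \<noteq> {}"
    using sphere_eq_empty[of "0::real^'n" 1] by simp
  ultimately obtain u where u: "u \<in> sphere 0 1"
      "\<And>z. z \<in> sphere 0 1 \<Longrightarrow> u \<bullet> (P *v u) \<le> z \<bullet> (P *v z)"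
    using continuous_attains_inf[OF compact_sphere] by blast
  show ?thesis
  proof
    show "u \<bullet> (P *v u) > 0"
      using assms u(1) unfolding sym_pos_def_def by (metis mem_sphere_0 norm_zero zero_neq_one)
    fix z :: "real^'n"
    show "(u \<bullet> (P *v u)) * (norm z)\<^sup>2 \<le> z \<bullet> (P *v z)"
    proof (cases "z = 0")
      case False
      have "u \<bullet> (P *v u) \<le> (z /\<^sub>R norm z) \<bullet> (P *v (z /\<^sub>R norm z))"
        using False by (intro u(2)) simp
      then show ?thesis
        using False by (simp add: matrix_vector_mult_scaleR field_simps power2_eq_square)
    qed simp
  qed
qed

lemma sym_pos_def_inner_commute:
  assumes "sym_pos_def P"
  shows "u \<bullet> (P *v v) = v \<bullet> (P *v u)"
  using assms by (metis dot_lmul_matrix inner_commute sym_pos_def_def vector_transpose_matrix)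

lemma sym_pos_def_inverse:
  assumes "sym_pos_def S"
  shows "S *v (matrix_inv S *v x) = x" "sym_pos_def (matrix_inv S)"
proof -
  have "inj ((*v) S)"
  proof (rule injI)
    fix x y assume "S *v x = S *v y"
    then have "(x - y) \<bullet> (S *v (x - y)) = 0"
      by (simp add: matrix_vector_mult_diff_distrib)
    then show "x = y"
      using assms unfolding sym_pos_def_def by (metis less_irrefl right_minus_eq)
  qed
  then have "invertible S"
    by (metis invertible_left_inverse matrix_left_invertible_injective)
  then have eq: "S ** matrix_inv S = mat 1 \<and> matrix_inv S ** S = mat 1"
    unfolding invertible_def matrix_inv_def by (rule someI_ex)
  show 1: "S *v (matrix_inv S *v x) = x" for x
    using eq by (simp add: matrix_vector_mul_assoc)
  have "S ** transpose (matrix_inv S) = transpose (matrix_inv S ** S)"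
    using assms by (simp add: matrix_transpose_mul sym_pos_def_def)
  also have "\<dots> = mat 1"
    using eq by (simp add: transpose_mat)
  finally have "matrix_inv S ** (S ** transpose (matrix_inv S)) = matrix_inv S"
    by simp
  then have "transpose (matrix_inv S) = matrix_inv S"
    using eq by (simp add: matrix_mul_assoc)
  moreover have "0 < x \<bullet> (matrix_inv S *v x)" if "x \<noteq> 0" for x
  proof -
    have "0 < (matrix_inv S *v x) \<bullet> (S *v (matrix_inv S *v x))"
      using assms 1[of x] that unfolding sym_pos_def_def by (metis matrix_vector_mult_0_right)
    then show ?thesis
      by (simp add: 1 inner_commute)
  qed
  ultimately show "sym_pos_def (matrix_inv S)"
    by (simp add: sym_pos_def_def)
qed

text \<open>The balance condition makes \<open>z = 0\<close> the critical point of the left-hand side, so the terms linear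
  in \<open>z\<close> cancel. With \<open>c = 1 + \<beta>\<close>, \<open>a = x - \<mu>\<close>, \<open>b = \<mu> - m\<close> and \<open>z = y - \<mu>\<close> the left-hand side is
  \<open>- 2\<close> times the exponent of \<open>k x y * exp (- \<beta> * V y) * exp (- V y)\<close>.\<close>
lemma complete_the_square:
  fixes A B :: "real^'n^'n"
  assumes "sym_pos_def A" "sym_pos_def B" and balance: "A *v a = c *\<^sub>R (B *v b)"
  shows "(a - z) \<bullet> (A *v (a - z)) + c * ((z + b) \<bullet> (B *v (z + b)))
    = (a \<bullet> (A *v a) + c * (b \<bullet> (B *v b))) + z \<bullet> (A *v z + c *\<^sub>R (B *v z))"
proof -
  have cross: "z \<bullet> (A *v a) = c * (z \<bullet> (B *v b))"
    by (simp add: balance)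
  have sym: "a \<bullet> (A *v z) = z \<bullet> (A *v a)" "b \<bullet> (B *v z) = z \<bullet> (B *v b)"
    using assms(1,2) sym_pos_def_inner_commute by blast+
  show ?thesis
    by (simp add: matrix_vector_mult_diff_distrib matrix_vector_right_distrib inner_diff_left
          inner_diff_right inner_add_left inner_add_right sym cross distrib_left)
qed

section \<open>Gaussian integrals\<close>

lemma integrable_exp_neg_norm_sq:
  assumes "c > 0"
  shows "integrable lborel (\<lambda>z::'a::euclidean_space. exp (- c * (norm z)\<^sup>2))"
proof (rule integrableI_nonneg)
  define \<sigma> where "\<sigma> = 1 / sqrt (2 * c)"
  have \<sigma>: "\<sigma> > 0" "\<sigma>\<^sup>2 = 1 / (2 * c)"
    using assms by (auto simp: \<sigma>_def power_divide)
  have "integrable lborel (\<lambda>t. sqrt (2 * pi * \<sigma>\<^sup>2) * normal_density 0 \<sigma> t)"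
    using \<sigma> by (intro integrable_mult_right integrable_normal_density)
  also have "(\<lambda>t. sqrt (2 * pi * \<sigma>\<^sup>2) * normal_density 0 \<sigma> t) = (\<lambda>t. exp (- c * t\<^sup>2))"
    using \<sigma> assms by (auto simp: normal_density_def field_simps)
  finally have fin: "(\<integral>\<^sup>+t. ennreal (exp (- c * t\<^sup>2)) \<partial>lborel) < \<infinity>"
    by (subst (asm) integrable_iff_bounded) auto
  have "ennreal (exp (- c * (norm z)\<^sup>2)) = (\<Prod>b\<in>Basis. ennreal (exp (- c * (z \<bullet> b)\<^sup>2)))" for z :: 'a
  proof -
    have "(norm z)\<^sup>2 = (\<Sum>b\<in>Basis. (z \<bullet> b)\<^sup>2)"
      by (subst power2_norm_eq_inner, subst euclidean_inner) (simp add: power2_eq_square)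
    then show ?thesis
      by (simp add: prod_ennreal sum_distrib_left exp_sum sum_negf[symmetric])
  qed
  then show "(\<integral>\<^sup>+z. ennreal (exp (- c * (norm (z::'a))\<^sup>2)) \<partial>lborel) < \<infinity>"
    using fin nn_integral_lborel_prod[where ?'a='a and f="\<lambda>b t. ennreal (exp (- c * t\<^sup>2))"]
    by (simp add: less_top[symmetric] power_eq_top_ennreal)
qed auto

text \<open>Unnormalized, since weighted moments are quotients by the total mass. The matrix is the precision
  matrix, that is, the inverse of the covariance.\<close>
definition centred_gaussian :: "real^'n^'n \<Rightarrow> real^'n \<Rightarrow> real" where
  "centred_gaussian P z = exp (- (1/2) * (z \<bullet> (P *v z)))"

lemma borel_measurable_centred_gaussian [measurable]:
  "centred_gaussian P \<in> borel_measurable borel"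
  unfolding centred_gaussian_def by (intro borel_measurable_continuous_onI continuous_intros)

lemma centred_gaussian_pos: "0 < centred_gaussian P z"
  by (simp add: centred_gaussian_def)

text \<open>Every integrand below grows at most exponentially relative to the Gaussian, so this one
  criterion covers moments as well as the dominating functions for limits under the integral sign.\<close>
lemma integrable_centred_gaussian:
  fixes h :: "real^'n \<Rightarrow> 'b::{banach, second_countable_topology}"
  assumes P: "sym_pos_def P" and [measurable]: "h \<in> borel_measurable borel"
    and h: "\<And>z. norm (h z) \<le> K * exp (b * norm z)"
  shows "integrable lborel (\<lambda>z. centred_gaussian P z *\<^sub>R h z)"
proof -
  obtain c where c: "c > 0" "\<And>z. c * (norm z)\<^sup>2 \<le> z \<bullet> (P *v z)"
    using sym_pos_def_coercive[OF P] by blast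
  have K: "K \<ge> 0"
    using order_trans[OF norm_ge_zero h[of 0]] by simp
  have "integrable lborel (\<lambda>z::real^'n. K * exp (b\<^sup>2 / c) * exp (- (c/4) * (norm z)\<^sup>2))"
    using c by (intro integrable_mult_right integrable_exp_neg_norm_sq) simp
  then show ?thesis
  proof (rule Bochner_Integration.integrable_bound)
    have "norm (centred_gaussian P z *\<^sub>R h z) \<le> K * exp (b\<^sup>2 / c) * exp (- (c/4) * (norm z)\<^sup>2)" for z
    proof -
      \<comment> \<open>Half of the quadratic decay \<open>c/2\<close> absorbs the linear exponent, the other half stays integrable.\<close>
      have "0 \<le> c * (norm z / 2 - b / c)\<^sup>2"
        using c by simp
      also have "\<dots> = b\<^sup>2 / c + (c/4) * (norm z)\<^sup>2 - b * norm z"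
        using c by (simp add: power2_diff field_simps power2_eq_square)
      finally have "b * norm z - (1/2) * (z \<bullet> (P *v z)) \<le> b\<^sup>2 / c - (c/4) * (norm z)\<^sup>2"
        using c(2)[of z] by simp
      then have "exp (b * norm z - (1/2) * (z \<bullet> (P *v z))) \<le> exp (b\<^sup>2 / c - (c/4) * (norm z)\<^sup>2)"
        by simp
      then have "K * (exp (b * norm z) * centred_gaussian P z) \<le> K * (exp (b\<^sup>2 / c) * exp (- (c/4) * (norm z)\<^sup>2))"
        using K by (intro mult_left_mono) (simp_all add: centred_gaussian_def flip: exp_add)
      moreover have "centred_gaussian P z * norm (h z) \<le> centred_gaussian P z * (K * exp (b * norm z))"
        by (intro mult_left_mono h) (simp add: centred_gaussian_def)
      ultimately have "centred_gaussian P z * norm (h z) \<le> K * (exp (b\<^sup>2 / c) * exp (- (c/4) * (norm z)\<^sup>2))"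
        by (simp add: mult_ac)
      then show ?thesis
        by (simp add: centred_gaussian_def mult_ac)
    qed
    then show "AE z in lborel. norm (centred_gaussian P z *\<^sub>R h z)
        \<le> norm (K * exp (b\<^sup>2 / c) * exp (- (c/4) * (norm z)\<^sup>2))"
      using K by (simp add: abs_mult)
  qed measurable
qed

lemma integral_lborel_translation:
  fixes f :: "'a::euclidean_space \<Rightarrow> 'b::{banach, second_countable_topology}"
  assumes [measurable]: "f \<in> borel_measurable borel"
  shows "integrable lborel (\<lambda>y. f (c + y)) \<longleftrightarrow> integrable lborel f"
    and "(LINT y|lborel. f (c + y)) = (LINT y|lborel. f y)"
proof -
  show "integrable lborel (\<lambda>y. f (c + y)) \<longleftrightarrow> integrable lborel f"
    using integrable_distr_eq[of "(+) c" lborel borel f] by (simp add: lborel_distr_plus)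
  show "(LINT y|lborel. f (c + y)) = (LINT y|lborel. f y)"
    using integral_distr[of "(+) c" lborel borel f] by (simp add: lborel_distr_plus)
qed

lemma integral_lborel_reflection:
  fixes f :: "'a::euclidean_space \<Rightarrow> 'b::{banach, second_countable_topology}"
  assumes [measurable]: "f \<in> borel_measurable borel"
  shows "(LINT y|lborel. f (- y)) = (LINT y|lborel. f y)"
proof -
  have "distr lborel borel uminus = (lborel :: 'a measure)"
    using lborel_affine[of "-1" "0::'a"] by (simp add: density_1 uminus_add_conv_diff cong: distr_cong)
  then show ?thesis
    using integral_distr[of "uminus :: 'a \<Rightarrow> 'a" lborel borel f] by simp
qed

lemma norm_le_exp: "norm z \<le> exp (norm z)"
  using exp_ge_add_one_self[of "norm z"] by linarith

lemma abs_exp_minus_one_le: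
  fixes a :: real
  shows "\<bar>exp a - 1\<bar> \<le> \<bar>a\<bar> * exp \<bar>a\<bar>"
proof (cases "a \<ge> 0")
  case True
  have "1 - exp (- a) \<le> a"
    using exp_ge_add_one_self[of "- a"] by linarith
  then have "exp a * (1 - exp (- a)) \<le> exp a * a"
    by (intro mult_left_mono) auto
  then show ?thesis
    using True by (simp add: algebra_simps exp_minus_inverse)
next
  case False
  then have "exp a \<le> 1"
    by simp
  then have "\<bar>exp a - 1\<bar> \<le> \<bar>a\<bar>"
    using False exp_ge_add_one_self[of a] by linarith
  also have "\<dots> \<le> \<bar>a\<bar> * exp \<bar>a\<bar>"
    by (simp add: mult_le_cancel_left1)
  finally show ?thesis .
qed

lemma integral_centred_gaussian_pos:
  assumes "sym_pos_def P"
  shows "integrable lborel (centred_gaussian P)" "0 < (LINT z|lborel. centred_gaussian P z)"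
proof -
  show i: "integrable lborel (centred_gaussian P)"
    using integrable_centred_gaussian[OF assms, of "\<lambda>_. 1::real" 1 0] by simp
  have "(LINT z|lborel. centred_gaussian P z) \<noteq> 0"
  proof
    assume "(LINT z|lborel. centred_gaussian P z) = 0"
    then have "AE z in lborel. centred_gaussian P z = 0"
      using integral_nonneg_eq_0_iff_AE[OF i] AE_I2[of lborel "\<lambda>z. 0 \<le> centred_gaussian P z"]
        centred_gaussian_pos[THEN less_imp_le] by blast
    then have "AE z in (lborel :: (real^'a) measure). False"
      by (simp add: centred_gaussian_def)
    then show False
      using AE_E2[of "\<lambda>_. False" "lborel :: (real^'a) measure"] by simp
  qed
  moreover have "0 \<le> (LINT z|lborel. centred_gaussian P z)"
    by (intro Bochner_Integration.integral_nonneg less_imp_le centred_gaussian_pos)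
  ultimately show "0 < (LINT z|lborel. centred_gaussian P z)"
    by linarith
qed

lemma centred_gaussian_first_moment:
  assumes "sym_pos_def P"
  shows "integrable lborel (\<lambda>z. centred_gaussian P z *\<^sub>R z)"
    and "(LINT z|lborel. centred_gaussian P z *\<^sub>R z) = 0"
proof -
  show "integrable lborel (\<lambda>z. centred_gaussian P z *\<^sub>R z)"
    by (rule integrable_centred_gaussian[OF assms, where K=1 and b=1]) (simp_all add: norm_le_exp)
  have "(LINT z|lborel. centred_gaussian P z *\<^sub>R z)
      = (LINT z|lborel. centred_gaussian P (- z) *\<^sub>R (- z))"
    by (rule integral_lborel_reflection[symmetric]) measurable
  also have "\<dots> = - (LINT z|lborel. centred_gaussian P z *\<^sub>R z)"
    by (simp add: centred_gaussian_def vec.neg)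
  finally have odd: "(LINT z|lborel. centred_gaussian P z *\<^sub>R z)
      = - (LINT z|lborel. centred_gaussian P z *\<^sub>R z)" .
  have "2 *\<^sub>R (LINT z|lborel. centred_gaussian P z *\<^sub>R z) = 0"
    unfolding scaleR_2 by (subst (2) odd) (rule right_minus)
  then show "(LINT z|lborel. centred_gaussian P z *\<^sub>R z) = 0"
    by simp
qed

lemma centred_gaussian_shift:
  assumes "sym_pos_def P"
  shows "centred_gaussian P (z + t *\<^sub>R v)
    = centred_gaussian P z * exp (- t * (z \<bullet> (P *v v)) - t\<^sup>2 / 2 * (v \<bullet> (P *v v)))"
  unfolding centred_gaussian_def
  using sym_pos_def_inner_commute[OF assms, of z v]
  by (simp add: matrix_vector_right_distrib matrix_vector_mult_scaleR inner_add algebra_simps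
      power2_eq_square flip: exp_add)

text \<open>Integration by parts without boundary terms. Translating the variable in the vanishing first moment
  gives that the integral of \<open>g (z + t v) (z + t v)\<close> is zero for every \<open>t\<close>, hence the integral of
  \<open>g (z + t v) z\<close> is \<open>- t v\<close> times the total mass. Its derivative at \<open>t = 0\<close>, taken
  under the integral sign, is the claim, because the derivative of \<open>g\<close> at \<open>z\<close> in direction
  \<open>v\<close> is \<open>- (z \<bullet> P v) g z\<close>.\<close>
lemma centred_gaussian_second_moment:
  assumes P: "sym_pos_def P"
  shows "(LINT z|lborel. centred_gaussian P z *\<^sub>R ((z \<bullet> (P *v v)) *\<^sub>R z))
    = (LINT z|lborel. centred_gaussian P z) *\<^sub>R v"
proof -
  let ?g = "centred_gaussian P"
  define t where "t n = 1 / real (Suc n)" for n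
  have t: "t n > 0" "t n \<le> 1" for n
    by (auto simp: t_def)
  have t0: "t \<longlonglongrightarrow> 0"
    unfolding t_def by (rule lim_1_over_n[THEN LIMSEQ_Suc])
  \<comment> \<open>The exponent relating \<open>g (z + t v)\<close> to \<open>g z\<close>, see \<open>centred_gaussian_shift\<close>.\<close>
  define a where "a n z = - t n * (z \<bullet> (P *v v)) - (t n)\<^sup>2 / 2 * (v \<bullet> (P *v v))" for n z
  define p where "p = norm (P *v v)"
  define q where "q = v \<bullet> (P *v v)"
  have q: "q \<ge> 0"
    using P unfolding q_def sym_pos_def_def by (cases "v = 0") (auto simp: less_imp_le)
  have a_le: "\<bar>a n z\<bar> \<le> t n * (p * norm z + q)" for n z
  proof -
    have "\<bar>a n z\<bar> \<le> t n * \<bar>z \<bullet> (P *v v)\<bar> + (t n)\<^sup>2 / 2 * q"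
      unfolding a_def q_def[symmetric] using t(1)[of n] q
      by (intro order_trans[OF abs_triangle_ineq4]) (simp add: abs_mult)
    also have "\<dots> \<le> t n * (p * norm z) + t n * q"
    proof (intro add_mono mult_left_mono mult_right_mono)
      show "\<bar>z \<bullet> (P *v v)\<bar> \<le> p * norm z"
        unfolding p_def by (metis Cauchy_Schwarz_ineq2 mult.commute)
      show "(t n)\<^sup>2 / 2 \<le> t n"
        using t[of n] mult_left_mono[of "t n" 1 "t n"] by (simp add: power2_eq_square)
    qed (use t(1)[of n] q in auto)
    finally show ?thesis by (simp add: algebra_simps)
  qed
  \<comment> \<open>The difference quotient of \<open>t \<mapsto> g (z + t v) z\<close>. The factor \<open>g z\<close> is split off so that what
    remains is bounded by an exponential of \<open>norm z\<close>, uniformly in \<open>n\<close>.\<close>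
  define s where "s n z = ?g z *\<^sub>R (((exp (a n z) - 1) / t n) *\<^sub>R z)" for n and z :: "real^'a"
  have bound: "norm (((exp (a n z) - 1) / t n) *\<^sub>R z) \<le> exp (2 * q) * exp ((2 * p + 1) * norm z)" for n z
  proof -
    \<comment> \<open>Dividing \<open>\<bar>exp a - 1\<bar> \<le> \<bar>a\<bar> * exp \<bar>a\<bar>\<close> by \<open>t n\<close> leaves at most \<open>?r * exp ?r\<close>, below \<open>exp (2 * ?r)\<close>.\<close>
    let ?r = "p * norm z + q"
    have r: "?r \<ge> 0" using q by (simp add: p_def)
    have "t n * ?r \<le> ?r"
      using r t[of n] by (simp add: mult_left_le_one_le less_imp_le)
    then have "\<bar>a n z\<bar> \<le> ?r"
      using a_le[of n z] by linarith
    then have "\<bar>a n z\<bar> * exp \<bar>a n z\<bar> \<le> (t n * ?r) * exp ?r"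
      using a_le[of n z] by (intro mult_mono) auto
    also have "\<dots> \<le> (t n * exp ?r) * exp ?r"
      using t(1)[of n] norm_le_exp[of ?r] r by (intro mult_right_mono mult_left_mono) auto
    finally have "\<bar>exp (a n z) - 1\<bar> / t n \<le> exp ?r * exp ?r"
      using abs_exp_minus_one_le[of "a n z"] t(1)[of n] by (simp add: field_simps)
    then have "\<bar>exp (a n z) - 1\<bar> / t n * norm z \<le> (exp ?r * exp ?r) * exp (norm z)"
      by (intro mult_mono norm_le_exp) auto
    also have "\<dots> = exp (2 * q) * exp ((2 * p + 1) * norm z)"
      by (simp add: algebra_simps flip: exp_add)
    finally show ?thesis
      using t(1)[of n] by (simp add: abs_divide)
  qed
  have [measurable]: "a n \<in> borel_measurable borel" for n
    unfolding a_def by measurable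
  have [measurable]: "s n \<in> borel_measurable borel" for n
    unfolding s_def by measurable
  have dom: "integrable lborel (\<lambda>z. ?g z *\<^sub>R (exp (2 * q) * exp ((2 * p + 1) * norm z)))"
    by (rule integrable_centred_gaussian[OF P, where K="exp (2*q)" and b="2*p+1"]) auto
  have lim: "(\<lambda>n. s n z) \<longlonglongrightarrow> - (?g z *\<^sub>R ((z \<bullet> (P *v v)) *\<^sub>R z))" for z
  proof -
    have "((\<lambda>h. exp (- h * (z \<bullet> (P *v v)) - h\<^sup>2 / 2 * (v \<bullet> (P *v v)))) has_real_derivative
        - (z \<bullet> (P *v v))) (at 0)"
      by (auto intro!: derivative_eq_intros)
    then have "((\<lambda>h. (exp (- h * (z \<bullet> (P *v v)) - h\<^sup>2 / 2 * (v \<bullet> (P *v v))) - 1) / h)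
        \<longlongrightarrow> - (z \<bullet> (P *v v))) (at 0)"
      by (simp add: DERIV_def)
    moreover have "filterlim t (at 0) sequentially"
      using t0 t(1) by (auto simp: filterlim_at intro!: always_eventually less_imp_neq[symmetric])
    ultimately have "(\<lambda>n. (exp (a n z) - 1) / t n) \<longlonglongrightarrow> - (z \<bullet> (P *v v))"
      unfolding a_def by (rule filterlim_compose)
    then have "(\<lambda>n. s n z) \<longlonglongrightarrow> ?g z *\<^sub>R ((- (z \<bullet> (P *v v))) *\<^sub>R z)"
      unfolding s_def by (intro tendsto_intros)
    then show ?thesis by simp
  qed
  have "(\<lambda>n. LINT z|lborel. s n z) \<longlonglongrightarrow> (LINT z|lborel. - (?g z *\<^sub>R ((z \<bullet> (P *v v)) *\<^sub>R z)))"
  proof (rule integral_dominated_convergence[OF _ _ dom])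
    show "AE z in lborel. norm (s n z) \<le> ?g z *\<^sub>R (exp (2 * q) * exp ((2 * p + 1) * norm z))" for n
      unfolding s_def norm_scaleR[of "?g _"] using bound[of n] centred_gaussian_pos[of P]
      by (auto intro!: mult_left_mono simp: less_imp_le simp del: norm_scaleR)
  qed (use lim in auto)
  moreover have "(LINT z|lborel. s n z) = - ((LINT z|lborel. ?g z) *\<^sub>R v)" for n
  proof -
    have i1: "integrable lborel (\<lambda>z. ?g (z + t n *\<^sub>R v) *\<^sub>R (z + t n *\<^sub>R v))"
      and e1: "(LINT z|lborel. ?g (z + t n *\<^sub>R v) *\<^sub>R (z + t n *\<^sub>R v)) = 0"
      using integral_lborel_translation[of "\<lambda>z. ?g z *\<^sub>R z" "t n *\<^sub>R v"]
        centred_gaussian_first_moment[OF P] by (simp_all add: add.commute)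
    have i2: "integrable lborel (\<lambda>z. ?g (z + t n *\<^sub>R v))"
      and e2: "(LINT z|lborel. ?g (z + t n *\<^sub>R v)) = (LINT z|lborel. ?g z)"
      using integral_lborel_translation[of "?g" "t n *\<^sub>R v"]
        integral_centred_gaussian_pos[OF P] by (simp_all add: add.commute)
    have "s n z = (?g (z + t n *\<^sub>R v) *\<^sub>R (z + t n *\<^sub>R v) - ?g z *\<^sub>R z) /\<^sub>R t n
        - ?g (z + t n *\<^sub>R v) *\<^sub>R v" for z
      using t(1)[of n] unfolding s_def a_def centred_gaussian_shift[OF P]
      by (simp add: vec_eq_iff diff_divide_distrib) (simp add: field_simps)
    then show ?thesis
      using i1 i2 e1 e2 centred_gaussian_first_moment[OF P]
      by simp
  qed
  ultimately have "- ((LINT z|lborel. ?g z) *\<^sub>R v) = (LINT z|lborel. - (?g z *\<^sub>R ((z \<bullet> (P *v v)) *\<^sub>R z)))"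
    by (simp add: LIMSEQ_const_iff)
  then show ?thesis by simp
qed

section \<open>Weighted moments under a Gaussian weight\<close>

lemma outer_product_nth: "outer_product u v $ i = u $ i *\<^sub>R v"
  by (simp add: outer_product_def vec_eq_iff)

lemma norm_outer_product: "norm (outer_product u v) = norm u * norm v"
  by (simp only: norm_vec_def[of "outer_product u v"] norm_vec_def[of u] outer_product_nth
      norm_scaleR real_norm_def L2_set_left_distrib[OF norm_ge_zero])

lemma outer_product_mult_vec: "outer_product u v *v w = (v \<bullet> w) *\<^sub>R u"
  by (simp add: outer_product_def matrix_vector_mult_def vec_eq_iff inner_vec_def
      sum_distrib_left mult_ac)

lemma borel_measurable_outer_product [measurable]:
  "(\<lambda>z. outer_product z z) \<in> borel_measurable borel"
  unfolding outer_product_def by (intro borel_measurable_continuous_onI continuous_intros)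

lemma bounded_linear_mult_vec: "bounded_linear (\<lambda>A::real^'n^'m. A *v w)"
  by (rule linear_conv_bounded_linear[THEN iffD1], rule linearI)
    (simp_all add: matrix_vector_mult_add_rdistrib scaleR_matrix_vector_assoc)

lemma gaussian_weighted_integral:
  fixes f :: "real^'n \<Rightarrow> 'b::{banach, second_countable_topology}"
  assumes [measurable]: "\<rho> \<in> borel_measurable borel" "w \<in> borel_measurable borel" "f \<in> borel_measurable borel"
    and \<rho>: "\<And>y. 0 \<le> \<rho> y"
    and K: "K \<noteq> 0"
    and w: "\<And>y. \<rho> y * w y = K * centred_gaussian P (y - \<mu>)"
  shows "integrable (measure_of_density \<rho>) (\<lambda>y. w y *\<^sub>R f (y - \<mu>))
      \<longleftrightarrow> integrable lborel (\<lambda>z. centred_gaussian P z *\<^sub>R f z)"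
    and "(LINT y|measure_of_density \<rho>. w y *\<^sub>R f (y - \<mu>))
      = K *\<^sub>R (LINT z|lborel. centred_gaussian P z *\<^sub>R f z)"
proof -
  let ?h = "\<lambda>z. K *\<^sub>R (centred_gaussian P z *\<^sub>R f z)"
  have eq: "\<rho> y *\<^sub>R (w y *\<^sub>R f (y - \<mu>)) = ?h (- \<mu> + y)" for y
    using w[of y] by simp
  show "integrable (measure_of_density \<rho>) (\<lambda>y. w y *\<^sub>R f (y - \<mu>))
      \<longleftrightarrow> integrable lborel (\<lambda>z. centred_gaussian P z *\<^sub>R f z)"
  proof -
    have "integrable (measure_of_density \<rho>) (\<lambda>y. w y *\<^sub>R f (y - \<mu>))
        \<longleftrightarrow> integrable lborel (\<lambda>y. ?h (- \<mu> + y))"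
      using \<rho> unfolding measure_of_density_def
      by (subst integrable_density) (simp_all only: eq, simp_all)
    also have "\<dots> \<longleftrightarrow> integrable lborel ?h"
      by (rule integral_lborel_translation(1)) measurable
    also have "\<dots> \<longleftrightarrow> integrable lborel (\<lambda>z. centred_gaussian P z *\<^sub>R f z)"
    proof
      assume "integrable lborel ?h"
      then have "integrable lborel (\<lambda>z. inverse K *\<^sub>R ?h z)"
        by (rule integrable_scaleR_right)
      then show "integrable lborel (\<lambda>z. centred_gaussian P z *\<^sub>R f z)"
        using K by (simp flip: mult.assoc)
    qed (rule integrable_scaleR_right)
    finally show ?thesis .
  qed
  show "(LINT y|measure_of_density \<rho>. w y *\<^sub>R f (y - \<mu>))
      = K *\<^sub>R (LINT z|lborel. centred_gaussian P z *\<^sub>R f z)"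
  proof -
    have "(LINT y|measure_of_density \<rho>. w y *\<^sub>R f (y - \<mu>)) = (LINT y|lborel. ?h (- \<mu> + y))"
      using \<rho> unfolding measure_of_density_def
      by (subst integral_density) (simp_all only: eq, simp_all)
    also have "\<dots> = (LINT z|lborel. ?h z)"
      by (rule integral_lborel_translation(2)) measurable
    also have "\<dots> = K *\<^sub>R (LINT z|lborel. centred_gaussian P z *\<^sub>R f z)"
      by (rule integral_scaleR_right)
    finally show ?thesis .
  qed
qed

text \<open>The constant \<open>K\<close> cancels in the quotients defining mean and covariance, so only the centre and the
  precision matrix of the weight matter.\<close>
lemma gaussian_weighted_moments:
  fixes P :: "real^'n^'n"
  assumes P: "sym_pos_def P"
    and meas: "\<rho> \<in> borel_measurable borel" "weight k V \<beta> x \<in> borel_measurable borel"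
    and \<rho>: "\<And>y. 0 \<le> \<rho> y"
    and K: "K \<noteq> 0"
    and w: "\<And>y. \<rho> y * weight k V \<beta> x y = K * centred_gaussian P (y - \<mu>)"
  shows "weighted_moments_exist k V \<beta> (measure_of_density \<rho>) x"
    and "weighted_mean k V \<beta> (measure_of_density \<rho>) x = \<mu>"
    and "weighted_cov k V \<beta> (measure_of_density \<rho>) x *v (P *v u) = u"
proof -
  let ?M = "measure_of_density \<rho>" and ?w = "weight k V \<beta> x"
  define Z where "Z = K * (LINT z|lborel. centred_gaussian P z)"
  have Z: "Z \<noteq> 0"
    using K integral_centred_gaussian_pos(2)[OF P] by (simp add: Z_def)
  note transfer = gaussian_weighted_integral[OF meas _ \<rho> K w]
  have mass: "integrable ?M ?w" "(LINT y|?M. ?w y) = Z"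
    using transfer[of "\<lambda>_. 1::real"] integral_centred_gaussian_pos(1)[OF P] by (simp_all add: Z_def)
  have first: "integrable ?M (\<lambda>y. ?w y *\<^sub>R (y - \<mu>))" "(LINT y|?M. ?w y *\<^sub>R (y - \<mu>)) = 0"
    using transfer[of "\<lambda>z. z"] centred_gaussian_first_moment[OF P] by simp_all
  have split: "?w y *\<^sub>R y = ?w y *\<^sub>R (y - \<mu>) + ?w y *\<^sub>R \<mu>" for y
    by (simp add: scaleR_diff_right)
  have mean_int: "integrable ?M (\<lambda>y. ?w y *\<^sub>R y)"
    unfolding split using first mass by simp
  have "(LINT y|?M. ?w y *\<^sub>R y) = Z *\<^sub>R \<mu>"
    unfolding split using first mass by simp
  then show mean: "weighted_mean k V \<beta> ?M x = \<mu>"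
    using mass Z by (simp add: weighted_mean_def)
  have outer: "integrable lborel (\<lambda>z. centred_gaussian P z *\<^sub>R outer_product z z)"
  proof (rule integrable_centred_gaussian[OF P, where K=1 and b=2])
    fix z :: "real^'n"
    have "norm z * norm z \<le> exp (norm z) * exp (norm z)"
      by (intro mult_mono norm_le_exp) auto
    then show "norm (outer_product z z) \<le> 1 * exp (2 * norm z)"
      by (simp add: norm_outer_product flip: exp_add)
  qed measurable
  then have cov_int: "integrable ?M (\<lambda>y. ?w y *\<^sub>R outer_product (y - \<mu>) (y - \<mu>))"
    using transfer(1)[of "\<lambda>z. outer_product z z"] by simp
  show "weighted_moments_exist k V \<beta> ?M x"
    unfolding weighted_moments_exist_def mean using mass Z mean_int cov_int by simp
  have "(LINT y|?M. ?w y *\<^sub>R outer_product (y - \<mu>) (y - \<mu>)) *v (P *v u)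
      = K *\<^sub>R ((LINT z|lborel. centred_gaussian P z *\<^sub>R outer_product z z) *v (P *v u))"
    using transfer(2)[of "\<lambda>z. outer_product z z"] by (simp add: scaleR_matrix_vector_assoc)
  also have "(LINT z|lborel. centred_gaussian P z *\<^sub>R outer_product z z) *v (P *v u)
      = (LINT z|lborel. (centred_gaussian P z *\<^sub>R outer_product z z) *v (P *v u))"
    by (rule integral_bounded_linear[OF bounded_linear_mult_vec outer, symmetric])
  also have "\<dots> = (LINT z|lborel. centred_gaussian P z) *\<^sub>R u"
    using centred_gaussian_second_moment[OF P, of u]
    by (simp add: outer_product_mult_vec flip: scaleR_matrix_vector_assoc)
  finally have "(LINT y|?M. ?w y *\<^sub>R outer_product (y - \<mu>) (y - \<mu>)) *v (P *v u) = Z *\<^sub>R u"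
    by (simp add: Z_def)
  then show "weighted_cov k V \<beta> ?M x *v (P *v u) = u"
    unfolding weighted_cov_def mean mass(2) using Z
    by (simp flip: scaleR_matrix_vector_assoc)
qed

section \<open>Stationarity\<close>

lemma gradient_eq:
  assumes "GDERIV f x :> D"
  shows "gradient f x = D"
  unfolding gradient_def
proof (rule the_equality)
  show "GDERIV f x :> D" by (rule assms)
next
  fix D' assume "GDERIV f x :> D'"
  then have "(\<lambda>h. h \<bullet> D') = (\<lambda>h. h \<bullet> D)"
    using assms unfolding gderiv_def by (rule has_derivative_unique)
  then show "D' = D"
    by (metis inner_commute vector_eq_rdot)
qed

lemma divergence_scaleR:
  assumes "F differentiable (at x)"
  shows "divergence (\<lambda>x. c *\<^sub>R F x) x = c * divergence F x"
proof -
  have "((\<lambda>x. c *\<^sub>R F x) has_derivative (\<lambda>h. c *\<^sub>R frechet_derivative F (at x) h)) (at x)"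
    using assms by (intro has_derivative_scaleR_right) (simp add: frechet_derivative_works)
  then have "frechet_derivative (\<lambda>x. c *\<^sub>R F x) (at x) = (\<lambda>h. c *\<^sub>R frechet_derivative F (at x) h)"
    by (rule frechet_derivative_at[symmetric])
  then show ?thesis
    by (simp add: divergence_def jacobian_def trace_def matrix_def sum_distrib_left)
qed

lemma GDERIV_exp_quadratic_objective:
  fixes S :: "real^'n^'n"
  assumes "sym_pos_def S"
  shows "GDERIV (\<lambda>x. exp (- quadratic_objective S m x)) x
    :> - exp (- quadratic_objective S m x) *\<^sub>R (matrix_inv S *v (x - m))"
proof -
  let ?B = "matrix_inv S"
  note [derivative_intros] = bounded_linear.has_derivative[OF matrix_vector_mul_bounded_linear]
  have "((\<lambda>x. - quadratic_objective S m x) has_derivative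
      (\<lambda>h. - (1/2 * ((x - m) \<bullet> (?B *v h) + h \<bullet> (?B *v (x - m)))))) (at x)"
    unfolding quadratic_objective_def by (auto intro!: derivative_eq_intros)
  then have "GDERIV (\<lambda>x. - quadratic_objective S m x) x :> - (?B *v (x - m))"
    using sym_pos_def_inner_commute[OF sym_pos_def_inverse(2)[OF assms], of "x - m"]
    by (simp add: gderiv_def)
  from GDERIV_DERIV_compose[OF this DERIV_exp] show ?thesis
    by simp
qed

theorem proposition2p1:
  fixes S1 S2 :: "real^'n^'n" and m :: "real^'n" and \<beta> l :: real
  assumes "sym_pos_def S1" and "sym_pos_def S2"
    and "\<beta> > 0" and "l = inverse (1 + \<beta>)"
  shows "stationary_solution (gaussian_kernel S1) (quadratic_objective S2 m) \<beta> l
           (\<lambda>x. exp (- quadratic_objective S2 m x))"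
proof -
  define A where "A = matrix_inv S1"
  define B where "B = matrix_inv S2"
  define P where "P = A + (1 + \<beta>) *\<^sub>R B"
  define Q where "Q = matrix_inv P"
  define \<mu> where "\<mu> x = m + Q *v (A *v (x - m))" for x
  let ?k = "gaussian_kernel S1" and ?V = "quadratic_objective S2 m"
  define \<rho> where "\<rho> = (\<lambda>x. exp (- ?V x))"
  have AB: "sym_pos_def A" "sym_pos_def B"
    using assms sym_pos_def_inverse(2) by (auto simp: A_def B_def)
  have P_mult: "P *v z = A *v z + (1 + \<beta>) *\<^sub>R (B *v z)" for z
    by (simp add: P_def matrix_vector_mult_add_rdistrib scaleR_matrix_vector_assoc)
  have P: "sym_pos_def P"
    unfolding sym_pos_def_def
  proof (intro conjI allI impI)
    show "transpose P = P"
      using AB by (simp add: P_def sym_pos_def_def transpose_def vec_eq_iff)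
    show "0 < z \<bullet> (P *v z)" if "z \<noteq> 0" for z
      using AB that assms(3) by (simp add: P_mult sym_pos_def_def inner_add_right add_pos_pos)
  qed
  \<comment> \<open>The defining equation of \<open>\<mu>\<close> read in two ways: as the critical point condition needed to
    complete the square, and as the formula for the displacement that drives the drift.\<close>
  have balance: "A *v (x - \<mu> x) = (1 + \<beta>) *\<^sub>R (B *v (\<mu> x - m))"
    and P_disp: "P *v (x - \<mu> x) = (1 + \<beta>) *\<^sub>R (B *v (x - m))" for x
  proof -
    have "P *v (\<mu> x - m) = A *v (x - m)"
      by (simp add: \<mu>_def Q_def sym_pos_def_inverse(1)[OF P])
    then show "A *v (x - \<mu> x) = (1 + \<beta>) *\<^sub>R (B *v (\<mu> x - m))"
      and "P *v (x - \<mu> x) = (1 + \<beta>) *\<^sub>R (B *v (x - m))"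
      by (simp_all add: P_mult matrix_vector_mult_diff_distrib algebra_simps)
  qed
  have weight: "\<exists>K. K \<noteq> 0 \<and> (\<forall>y. \<rho> y * weight ?k ?V \<beta> x y = K * centred_gaussian P (y - \<mu> x))" for x
  proof (intro exI conjI allI)
    let ?a = "x - \<mu> x" and ?b = "\<mu> x - m"
    let ?K = "exp (- (1/2) * (?a \<bullet> (A *v ?a) + (1 + \<beta>) * (?b \<bullet> (B *v ?b))))"
    show "?K \<noteq> 0" by simp
    fix y
    let ?z = "y - \<mu> x"
    have xy: "x - y = ?a - ?z" and ym: "y - m = ?z + ?b" by simp_all
    have "(x - y) \<bullet> (A *v (x - y)) + (1 + \<beta>) * ((y - m) \<bullet> (B *v (y - m)))
        = (?a \<bullet> (A *v ?a) + (1 + \<beta>) * (?b \<bullet> (B *v ?b))) + ?z \<bullet> (P *v ?z)"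
      unfolding xy ym P_mult by (rule complete_the_square[OF AB balance])
    then have "- ?V y + (- (1/2) * ((x - y) \<bullet> (A *v (x - y))) + - \<beta> * ?V y)
       = - (1/2) * (?a \<bullet> (A *v ?a) + (1 + \<beta>) * (?b \<bullet> (B *v ?b))) + - (1/2) * (?z \<bullet> (P *v ?z))"
      unfolding quadratic_objective_def B_def[symmetric] by (simp add: algebra_simps)
    then show "\<rho> y * weight ?k ?V \<beta> x y = ?K * centred_gaussian P ?z"
      unfolding \<rho>_def weight_def gaussian_kernel_def centred_gaussian_def A_def[symmetric]
        exp_add[symmetric] by (rule arg_cong)
  qed
  note [continuous_intros] = bounded_linear.continuous_on[OF matrix_vector_mul_bounded_linear]
  have cont: "continuous_on UNIV \<rho>" "continuous_on UNIV (weight ?k ?V \<beta> x)" for x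
    unfolding \<rho>_def weight_def[abs_def] gaussian_kernel_def quadratic_objective_def
    by (intro continuous_intros)+
  have moments: "weighted_moments_exist ?k ?V \<beta> (measure_of_density \<rho>) x"
      "weighted_mean ?k ?V \<beta> (measure_of_density \<rho>) x = \<mu> x"
      "weighted_cov ?k ?V \<beta> (measure_of_density \<rho>) x *v (P *v u) = u" for x u
  proof -
    obtain K where "K \<noteq> 0" "\<And>y. \<rho> y * weight ?k ?V \<beta> x y = K * centred_gaussian P (y - \<mu> x)"
      using weight by blast
    note * = gaussian_weighted_moments[OF P cont[THEN borel_measurable_continuous_onI] _ this]
    show "weighted_moments_exist ?k ?V \<beta> (measure_of_density \<rho>) x"
      "weighted_mean ?k ?V \<beta> (measure_of_density \<rho>) x = \<mu> x"
      "weighted_cov ?k ?V \<beta> (measure_of_density \<rho>) x *v (P *v u) = u"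
      by (rule *; simp add: \<rho>_def)+
  qed
  have GDERIV_\<rho>: "GDERIV \<rho> x :> - \<rho> x *\<^sub>R (B *v (x - m))" for x
    unfolding \<rho>_def B_def by (rule GDERIV_exp_quadratic_objective[OF assms(2)])
  then have diff_\<rho>: "\<rho> differentiable (at x)" for x
    by (auto simp: gderiv_def intro: differentiableI)
  have drift: "drift_flux ?k ?V \<beta> \<rho> = (\<lambda>x. \<rho> x *\<^sub>R (x - \<mu> x))"
    by (simp add: drift_flux_def moments fun_eq_iff)
  have diff_drift: "drift_flux ?k ?V \<beta> \<rho> differentiable (at x)" for x
  proof -
    note [derivative_intros] = bounded_linear.has_derivative[OF matrix_vector_mul_bounded_linear]
    have "((\<lambda>x. x - \<mu> x) has_derivative (\<lambda>h. h - Q *v (A *v h))) (at x)"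
      unfolding \<mu>_def by (auto intro!: derivative_eq_intros)
    then show ?thesis
      unfolding drift by (intro differentiable_scaleR diff_\<rho> differentiableI)
  qed
  \<comment> \<open>The cancellation takes place between the fluxes themselves, since the covariance
    inverts the matrix \<open>P\<close> in the formula for \<open>B *v (x - m)\<close>.\<close>
  have diffusion: "diffusion_flux ?k ?V \<beta> \<rho> = (\<lambda>x. (- l) *\<^sub>R drift_flux ?k ?V \<beta> \<rho> x)"
  proof
    fix x
    have "B *v (x - m) = l *\<^sub>R (P *v (x - \<mu> x))"
      using assms(3,4) by (simp add: P_disp)
    then have "gradient \<rho> x = P *v ((- l * \<rho> x) *\<^sub>R (x - \<mu> x))"
      using gradient_eq[OF GDERIV_\<rho>, of x]
      by (simp add: matrix_vector_mult_scaleR vec.neg mult.commute)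
    then show "diffusion_flux ?k ?V \<beta> \<rho> x = (- l) *\<^sub>R drift_flux ?k ?V \<beta> \<rho> x"
      by (simp only: diffusion_flux_def moments(3) drift) simp
  qed
  have diff_diffusion: "diffusion_flux ?k ?V \<beta> \<rho> differentiable (at x)" for x
    unfolding diffusion by (intro differentiable_scaleR differentiable_const diff_drift)
  have "integrable lborel \<rho>"
  proof -
    have "integrable lborel (\<lambda>y. centred_gaussian B (- m + y))"
      using integral_lborel_translation(1)[of "centred_gaussian B" "- m"]
        integral_centred_gaussian_pos(1)[OF AB(2)] by simp
    also have "(\<lambda>y. centred_gaussian B (- m + y)) = \<rho>"
      by (simp add: \<rho>_def centred_gaussian_def quadratic_objective_def B_def fun_eq_iff)
    finally show ?thesis .
  qed
  then have "fokker_planck_rhs_exists ?k ?V \<beta> \<rho>"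
    unfolding fokker_planck_rhs_exists_def is_density_def
    using moments(1) diff_\<rho> diff_drift diff_diffusion by (simp add: \<rho>_def)
  moreover have "fokker_planck_rhs ?k ?V \<beta> l \<rho> x = 0" for x
    using assms(3,4) unfolding fokker_planck_rhs_def diffusion
    by (simp add: divergence_scaleR[OF diff_drift] del: scaleR_minus_left)
  ultimately show ?thesis
    unfolding stationary_solution_iff \<rho>_def by blast
qed

end
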